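(* Let $\mathbb{F}$ be a field with characteristic $2$. Let $V$ be an infinite-dimensional vector space over $\mathbb{F}$, let $\alpha \in \mathbb{F}$, and let $u$ be a finite-rank endomorphism of $V$ whose trace belongs to $\{0,\alpha\}$. Then $\alpha\,\mathrm{id}_V+u$ is the sum of three square-zero endomorphisms of $V$.
   Context: An endomorphism $a$ of $V$ is square-zero if $a \circ a=0$. The trace of a finite-rank endomorphism $u$ of $V$ is the trace of the endomorphism of $W$ induced by $u$, where $W$ is any finite-dimensional linear subspace of $V$ containing the image of $u$ (this does not depend on the choice of $W$). *)

theory Defs
  imports Complex_Main
begin

abbreviation endomorphism :: "('a::field \<Rightarrow> 'v::ab_group_add \<Rightarrow> 'v) \<Rightarrow> ('v \<Rightarrow> 'v) \<Rightarrow> bool" where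
  "endomorphism scale \<equiv> Vector_Spaces.linear scale scale"

(* The library's dim is 0 for every infinite-dimensional subspace, so
   finiteness of the dimension has to be stated through spanning sets. *)
definition finite_dim_subspace :: "('a::field \<Rightarrow> 'v::ab_group_add \<Rightarrow> 'v) \<Rightarrow> 'v set \<Rightarrow> bool" where
  "finite_dim_subspace scale W \<longleftrightarrow> (\<exists>S. finite S \<and> module.span scale S = W)"

definition finite_rank :: "('a::field \<Rightarrow> 'v::ab_group_add \<Rightarrow> 'v) \<Rightarrow> ('v \<Rightarrow> 'v) \<Rightarrow> bool" where
  "finite_rank scale u \<longleftrightarrow> endomorphism scale u \<and> finite_dim_subspace scale (range u)"

definition square_zero :: "('a::field \<Rightarrow> 'v::ab_group_add \<Rightarrow> 'v) \<Rightarrow> ('v \<Rightarrow> 'v) \<Rightarrow> bool" where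
  "square_zero scale a \<longleftrightarrow> endomorphism scale a \<and> a \<circ> a = (\<lambda>v. 0)"

(* Sum of the diagonal entries of the matrix of u in a chosen basis of W;
   meant for finite-dimensional W with u ` W \<subseteq> W. *)
definition trace_on :: "('a::field \<Rightarrow> 'v::ab_group_add \<Rightarrow> 'v) \<Rightarrow> 'v set \<Rightarrow> ('v \<Rightarrow> 'v) \<Rightarrow> 'a" where
  "trace_on scale W u =
     (let B = (SOME B. \<not> module.dependent scale B \<and> module.span scale B = W)
      in \<Sum>b\<in>B. module.representation scale B (u b) b)"

(* The subspace W used here is the image of u itself. The theorem trace_eq_trace_on
   below shows that any finite-dimensional W containing the image gives the same value,
   and the theorem trace_eq_sum_basis that the basis of W does not matter either. *)
definition finite_rank_trace :: "('a::field \<Rightarrow> 'v::ab_group_add \<Rightarrow> 'v) \<Rightarrow> ('v \<Rightarrow> 'v) \<Rightarrow> 'a" where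
  "finite_rank_trace scale u = trace_on scale (range u) u"

context vector_space
begin

lemma finite_dim_subspace_basis:
  assumes "finite_dim_subspace scale W" "independent B" "span B = W"
  shows "finite B"
proof -
  obtain S where "finite S" "span S = W"
    using assms(1) by (auto simp: finite_dim_subspace_def)
  then show ?thesis
    using independent_span_bound[of S B] assms span_superset[of B] by auto
qed

lemma sum_basis_independent:
  assumes u: "endomorphism scale u"
    and R: "finite R" "independent R" "span R = range u"
    and B: "finite B" "independent B" "range u \<subseteq> span B"
  shows "(\<Sum>b\<in>B. representation B (u b) b) = (\<Sum>r\<in>R. representation R (u r) r)"
proof -
  interpret u: Vector_Spaces.linear scale scale u by (rule u)
  have in_R: "u v \<in> span R" for v using R(3) by auto
  have R_sub: "r \<in> span B" if "r \<in> R" for r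
    using that R(3) B(3) span_base[of r R] by auto
  define f where "f r v = representation R (u v) r" for r v
  have f_add: "f r (v + w) = f r v + f r w" for r v w
    by (simp add: f_def u.add representation_add[OF R(2) in_R in_R])
  have f_scale: "f r (scale c v) = c * f r v" for r c v
    by (simp add: f_def u.scale representation_scale[OF R(2) in_R])
  have f_0: "f r 0 = 0" for r
    by (simp add: f_def u.zero representation_zero)
  have f_sum: "f r (\<Sum>b\<in>A. scale (g b) b) = (\<Sum>b\<in>A. g b * f r b)" for r A g
    by (induction A rule: infinite_finite_induct) (auto simp: f_0 f_add f_scale)
  have expand: "u b = (\<Sum>r\<in>R. scale (f r b) r)" for b
    unfolding f_def using sum_representation_eq[OF R(2) in_R R(1)] by simp
  have "representation B (u b) b = (\<Sum>r\<in>R. representation B r b * f r b)" for b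
  proof -
    have "representation B (u b) = representation B (\<Sum>r\<in>R. scale (f r b) r)"
      using expand[of b] by (rule arg_cong)
    also have "\<dots> = (\<lambda>c. \<Sum>r\<in>R. representation B (scale (f r b) r) c)"
      using R_sub by (intro representation_sum[OF B(2)] span_scale)
    finally show ?thesis
      by (simp add: representation_scale[OF B(2) R_sub] mult.commute)
  qed
  then have "(\<Sum>b\<in>B. representation B (u b) b)
      = (\<Sum>b\<in>B. \<Sum>r\<in>R. representation B r b * f r b)"
    by (rule sum.cong[OF refl])
  also have "\<dots> = (\<Sum>r\<in>R. \<Sum>b\<in>B. representation B r b * f r b)"
    by (rule sum.swap)
  also have "\<dots> = (\<Sum>r\<in>R. f r r)"
  proof (rule sum.cong)
    fix r assume "r \<in> R"
    then have "(\<Sum>b\<in>B. scale (representation B r b) b) = r"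
      using sum_representation_eq[OF B(2) R_sub B(1)] by simp
    then show "(\<Sum>b\<in>B. representation B r b * f r b) = f r r"
      using f_sum[of r "representation B r" B] by simp
  qed simp
  finally show ?thesis by (simp add: f_def)
qed

lemma some_basis:
  assumes "subspace W"
  shows "independent (SOME B. independent B \<and> span B = W) \<and>
    span (SOME B. independent B \<and> span B = W) = W"
proof (rule someI_ex)
  obtain B where B: "B \<subseteq> W" "independent B" "W \<subseteq> span B"
    by (rule basis_exists[of W])
  have "span B = W" by (rule span_subspace[OF B(1) B(3) assms])
  with B(2) show "\<exists>B. independent B \<and> span B = W" by (intro exI[of _ B] conjI)
qed

theorem trace_eq_sum_basis:
  assumes "finite_rank scale u" "finite B" "independent B" "range u \<subseteq> span B"
  shows "finite_rank_trace scale u = (\<Sum>b\<in>B. representation B (u b) b)"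
proof -
  define R where "R = (SOME R. independent R \<and> span R = range u)"
  have u: "endomorphism scale u" and fd: "finite_dim_subspace scale (range u)"
    using assms(1) by (auto simp: finite_rank_def)
  have "subspace (range u)" using fd subspace_span by (metis finite_dim_subspace_def)
  from some_basis[OF this] have R: "independent R" "span R = range u"
    by (auto simp: R_def)
  have "finite R" using finite_dim_subspace_basis[OF fd R] .
  from sum_basis_independent[OF u this R assms(2-4)] show ?thesis
    by (simp add: finite_rank_trace_def trace_on_def R_def Let_def)
qed

theorem trace_eq_trace_on:
  assumes "finite_rank scale u" "finite_dim_subspace scale W" "range u \<subseteq> W"
  shows "finite_rank_trace scale u = trace_on scale W u"
proof -
  define B where "B = (SOME B. independent B \<and> span B = W)"
  have "subspace W" using assms(2) subspace_span by (metis finite_dim_subspace_def)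
  from some_basis[OF this] have B: "independent B" "span B = W" by (auto simp: B_def)
  with trace_eq_sum_basis[OF assms(1) finite_dim_subspace_basis[OF assms(2) B]] assms(3)
  show ?thesis by (simp add: trace_on_def B_def Let_def)
qed

end

end

theory Submission
  imports Defs
begin

text \<open>
  Write \<open>M = \<alpha> id + u\<close>. Suppose that \<open>V = U \<oplus> U'\<close>, and that there are linear maps \<open>x : U' \<rightarrow> U\<close> and
  \<open>w : U \<rightarrow> U'\<close> such that the diagonal blocks of \<open>M\<close> are \<open>x w\<close> on \<open>U\<close> and \<open>w x\<close> on \<open>U'\<close>. In
  characteristic 2 the map \<open>1 + x\<close> is an involution, so \<open>a = (1 + x) w (1 + x)\<close> is a conjugate of the
  square-zero map \<open>w\<close>. Its diagonal blocks are \<open>x w\<close> and \<open>w x\<close> as well, so \<open>M + a\<close> maps \<open>U\<close> into \<open>U'\<close>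
  and \<open>U'\<close> into \<open>U\<close>, and hence is the sum of two square-zero maps, one for each corner
  (\<open>three_square_zero_of_blocks\<close>). The task is to find such a decomposition of \<open>V\<close>.

  Let \<open>I\<close> be the image of \<open>u\<close> and \<open>\<tau>\<close> the trace. A variant of Shoda's theorem, that matrices of trace
  zero are commutators, provides endomorphisms \<open>Q\<close>, \<open>Z\<close> of \<open>I\<close>, a vector \<open>k\<close> in the kernel of \<open>Q\<close> and a
  linear form \<open>\<phi>\<close> with \<open>\<phi> k = 1\<close> such that \<open>u v = Q Z v + Z Q v + \<tau> \<phi>(v) k\<close> on \<open>I\<close>
  (\<open>commutator_plus_rank_one\<close>). The image basis is chosen so that the matrix of \<open>u\<close> is upper
  Hessenberg with all subdiagonal entries 0 or 1, and \<open>Q\<close> is a backward shift of that basis. The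
  equation for \<open>Z\<close> can then be solved by recursion. Its only obstructions are the trace, which the
  rank-one term removes, and the sum of the subdiagonal entries, which is the parity of the number of
  ones. If this number is odd, then splitting off the first basis vector from the shift makes it even. As no
  scalars have to be chosen, this works over all fields of characteristic 2, \<open>\<bbbF>\<^sub>2\<close> included.

  The infinite-dimensional kernel of \<open>u\<close> leaves the room for a decomposition in which both diagonal blocks
  of \<open>u\<close> have \<open>Q Z\<close> as their essential part. The space \<open>U\<close> is the sum of a copy of \<open>I\<close> and an infinite-dimensional
  space \<open>Y\<close>; the space \<open>U'\<close> is the sum of further copies of \<open>I\<close> and \<open>Y\<close> and, if \<open>\<tau> \<noteq> 0\<close>, of the line
  of one vector \<open>l\<close> that carries the rank-one term. The compressions of \<open>u\<close> to \<open>U\<close> and to \<open>U'\<close> are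
  made to agree up to these identifications, apart from terms along \<open>l\<close> and the eigenvalue \<open>\<tau>\<close> at \<open>l\<close>. Here the
  hypothesis on the trace enters: if \<open>\<tau> = \<alpha>\<close>, then \<open>M\<close> compressed to \<open>U'\<close> vanishes at \<open>l\<close>, so it is
  \<open>w x\<close> with \<open>x\<close> the projection \<open>U' \<rightarrow> U\<close> along \<open>l\<close>; if \<open>\<tau> = 0\<close>, then no \<open>l\<close> is needed
  (\<open>three_square_zero_of_model\<close>).
\<close>

section \<open>Vector spaces in characteristic 2\<close>

locale char_two_space = vector_space scale
  for scale :: "'a::field \<Rightarrow> 'v::ab_group_add \<Rightarrow> 'v" (infixr "*s" 75) +
  assumes double_zero [simp]: "(v::'v) + v = 0"
begin

sublocale pair: vector_space_pair scale scale ..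

lemma double_cancel [simp]: "(v::'v) + (v + w) = w"
  by (simp flip: add.assoc)

lemma eq_iff_sum_zero: "(v::'v) = w \<longleftrightarrow> v + w = 0"
  by (metis double_cancel add.right_neutral)

lemma endo_add: "endomorphism scale f \<Longrightarrow> f (v + w) = f v + f w"
  by (rule module_hom.add[OF Vector_Spaces.linear.axioms(3)])

lemma endo_scale: "endomorphism scale f \<Longrightarrow> f (c *s v) = c *s f v"
  by (rule module_hom.scale[OF Vector_Spaces.linear.axioms(3)])

lemma endo_zero: "endomorphism scale f \<Longrightarrow> f 0 = 0"
  by (rule module_hom.zero[OF Vector_Spaces.linear.axioms(3)])

lemma endoI:
  assumes "\<And>v w. f (v + w) = f v + f w" "\<And>c v. f (c *s v) = c *s f v"
  shows "endomorphism scale f"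
  using assms by (simp add: Vector_Spaces.linear_iff vector_space_axioms)

lemma endo_funpow: "endomorphism scale f \<Longrightarrow> endomorphism scale (f ^^ n)"
  by (induction n) (auto intro!: endoI simp: endo_add endo_scale)

lemma endo_eq_on_basis:
  assumes "endomorphism scale f" "endomorphism scale g" "span B = UNIV"
    and "\<And>b. b \<in> B \<Longrightarrow> f b = g b"
  shows "f v = g v"
  using pair.linear_eq_on[OF assms(1,2), of v B] assms(3,4) by auto

lemma endo_into_span:
  assumes "endomorphism scale f" "span B = UNIV" "subspace S" "\<And>b. b \<in> B \<Longrightarrow> f b \<in> S"
  shows "f v \<in> S"
proof -
  have "v \<in> span B" using assms(2) by simp
  then show ?thesis
    by (induction rule: span_induct_alt)
      (use assms in \<open>auto simp: endo_zero endo_add endo_scale subspace_0 subspace_add subspace_scale\<close>)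
qed

lemma endo_from_basis:
  assumes "independent B" "span B = UNIV"
  shows "\<exists>f. endomorphism scale f \<and> (\<forall>b\<in>B. f b = g b)"
  using pair.linear_independent_extend[OF assms(1), of g] by blast

section \<open>Sums of three square-zero endomorphisms\<close>

definition three_square_zero :: "('v \<Rightarrow> 'v) \<Rightarrow> bool" where
  "three_square_zero M \<longleftrightarrow> (\<exists>a b c. square_zero scale a \<and> square_zero scale b \<and>
     square_zero scale c \<and> M = (\<lambda>v. a v + b v + c v))"

text \<open>
  The map \<open>\<pi>\<close> is the projection onto \<open>U\<close> along \<open>U'\<close>, and \<open>x\<close> and \<open>w\<close> are extended by zero, so that both
  have square zero. The complementary projection is \<open>1 + \<pi>\<close>. The summand
  \<open>a = (1 + x) w (1 + x) = w + x w + w x + x w x\<close> takes care of both diagonal blocks at once.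
\<close>

lemma three_square_zero_of_blocks:
  assumes lin: "endomorphism scale M" "endomorphism scale \<pi>" "endomorphism scale x" "endomorphism scale w"
    and \<pi>\<pi>: "\<And>v. \<pi> (\<pi> v) = \<pi> v"
    and \<pi>x: "\<And>v. \<pi> (x v) = x v" and x\<pi>: "\<And>v. x (\<pi> v) = 0"
    and \<pi>w: "\<And>v. \<pi> (w v) = 0" and w\<pi>: "\<And>v. w (\<pi> v) = w v"
    and upper: "\<And>v. \<pi> (M (\<pi> v)) = x (w v)"
    and lower: "\<And>v. M (v + \<pi> v) + \<pi> (M (v + \<pi> v)) = w (x v)"
  shows "three_square_zero M"
proof -
  note adds = lin[THEN endo_add] and scales = lin[THEN endo_scale] and zeros = lin[THEN endo_zero]
  define a where "a v = w (v + x v) + x (w (v + x v))" for v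
  define b where "b v = M (\<pi> v) + a (\<pi> v)" for v
  define c where "c v = M (v + \<pi> v) + a (v + \<pi> v)" for v
  have ww: "w (w v) = 0" for v by (metis w\<pi> \<pi>w zeros(4))
  have xx: "x (x v) = 0" for v by (metis x\<pi> \<pi>x)
  have a_lin: "endomorphism scale a"
    by (intro endoI) (simp_all add: a_def adds scales scale_right_distrib ac_simps)
  have b_lin: "endomorphism scale b"
    by (intro endoI) (simp_all add: b_def adds scales endo_add[OF a_lin] endo_scale[OF a_lin]
        scale_right_distrib ac_simps)
  have "endomorphism scale (\<lambda>v. v + \<pi> v)"
    by (intro endoI) (simp_all add: adds scales scale_right_distrib ac_simps)
  then have c_lin: "endomorphism scale c"
    by (intro endoI) (simp_all only: c_def endo_add endo_scale lin a_lin
        scale_right_distrib ac_simps)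
  have aa: "a (a v) = 0" for v
    by (simp add: a_def adds ww xx zeros)
  have \<pi>b: "\<pi> (b v) = 0" for v
    by (simp add: b_def a_def adds zeros x\<pi> w\<pi> \<pi>x \<pi>w upper)
  have bb: "b (b v) = 0" for v
    using \<pi>b[of v] by (simp add: b_def[of "b v"] zeros endo_zero[OF a_lin])
  have wc: "w (v + \<pi> v) = 0" for v
    by (simp add: adds w\<pi>)
  have xc: "x (v + \<pi> v) = x v" for v
    by (simp add: adds x\<pi>)
  have ac: "a (v + \<pi> v) = w (x v) + x (w (x v))" for v
  proof -
    have "w (v + \<pi> v + x (v + \<pi> v)) = w (x v)"
      using endo_add[OF lin(4), of "v + \<pi> v" "x v"] by (simp only: wc xc add_0)
    then show ?thesis by (simp only: a_def)
  qed
  have "c v + \<pi> (c v) = 0" for v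
  proof -
    have "c v + \<pi> (c v) = (M (v + \<pi> v) + \<pi> (M (v + \<pi> v))) + (w (x v) + x (w (x v)) + x (w (x v)))"
      unfolding c_def ac by (simp only: endo_add[OF lin(2)] \<pi>x \<pi>w ac_simps add_0)
    then show ?thesis by (simp add: lower add.assoc)
  qed
  then have \<pi>c: "\<pi> (c v) = c v" for v by (metis eq_iff_sum_zero)
  have cc: "c (c v) = 0" for v
    unfolding c_def[of "c v"] \<pi>c by (simp add: zeros endo_zero[OF a_lin])
  have "a v + b v + c v = M v" for v
    by (simp add: b_def c_def adds endo_add[OF a_lin] ac_simps)
  then show ?thesis
    unfolding three_square_zero_def square_zero_def
    by (intro exI[of _ a] exI[of _ b] exI[of _ c]) (auto simp: a_lin b_lin c_lin aa bb cc)
qed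

lemma three_square_zero_conj:
  assumes M: "three_square_zero M" and T: "endomorphism scale T" "endomorphism scale T'"
    and inv: "\<And>v. T' (T v) = v" "\<And>v. T (T' v) = v"
  shows "three_square_zero (\<lambda>v. T (M (T' v)))"
proof -
  have conj: "square_zero scale (\<lambda>v. T (f (T' v)))" if "square_zero scale f" for f
  proof -
    have f: "endomorphism scale f" and ff: "\<And>v. f (f v) = 0"
      using that by (auto simp: square_zero_def fun_eq_iff)
    have "endomorphism scale (\<lambda>v. T (f (T' v)))"
      by (intro endoI) (simp_all add: endo_add endo_scale f T)
    then show ?thesis
      by (auto simp: square_zero_def inv ff endo_zero[OF T(1)])
  qed
  from M obtain a b c where sq: "square_zero scale a" "square_zero scale b" "square_zero scale c"
    and eq: "M = (\<lambda>v. a v + b v + c v)"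
    unfolding three_square_zero_def by blast
  have "(\<lambda>v. T (M (T' v))) = (\<lambda>v. T (a (T' v)) + T (b (T' v)) + T (c (T' v)))"
    by (simp add: eq endo_add[OF T(1)])
  then show ?thesis
    unfolding three_square_zero_def using sq[THEN conj] by blast
qed

section \<open>Commutators and Hessenberg matrices\<close>

text \<open>
  If \<open>Q\<close> shifts vectors \<open>f i\<close> backwards, then the equation \<open>Q (Z (f i)) + Z (Q (f i)) = G i\<close> for
  \<open>i > 0\<close> expresses \<open>\<zeta> (i - 1) = Z (f (i - 1))\<close> through \<open>\<zeta> i = Z (f i)\<close>. So the last value \<open>z\<close> is
  free and determines the others, and at \<open>f 0\<close>, where \<open>Z (Q (f 0))\<close> vanishes, one condition is left over.
\<close>

lemma shift_recursion:
  assumes Q: "endomorphism scale Q"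
    and S: "subspace S" "\<And>v. v \<in> S \<Longrightarrow> Q v \<in> S" "\<And>i. i \<le> n \<Longrightarrow> G i \<in> S" "z \<in> S"
  shows "\<exists>\<zeta>. (\<forall>i\<le>n. \<zeta> i \<in> S) \<and> \<zeta> n = z \<and> (\<forall>i<n. Q (\<zeta> (Suc i)) + \<zeta> i = G (Suc i)) \<and>
    Q (\<zeta> 0) + G 0 = (Q ^^ Suc n) z + (\<Sum>j\<le>n. (Q ^^ j) (G j))"
  using S(3,4)
proof (induction n arbitrary: z)
  case 0
  then show ?case by (intro exI[of _ "\<lambda>_. z"]) auto
next
  case (Suc n)
  define z' where "z' = Q z + G (Suc n)"
  have "z' \<in> S" using Suc.prems S by (auto simp: z'_def subspace_add)
  with Suc.IH[of z'] Suc.prems obtain \<zeta> where \<zeta>: "\<forall>i\<le>n. \<zeta> i \<in> S"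
    "\<forall>i<n. Q (\<zeta> (Suc i)) + \<zeta> i = G (Suc i)"
    "Q (\<zeta> 0) + G 0 = (Q ^^ Suc n) z' + (\<Sum>j\<le>n. (Q ^^ j) (G j))" "\<zeta> n = z'"
    by auto
  have "(Q ^^ Suc n) z' = (Q ^^ Suc (Suc n)) z + (Q ^^ Suc n) (G (Suc n))"
    unfolding z'_def endo_add[OF endo_funpow[OF Q]] by (simp add: funpow_swap1)
  with \<zeta> Suc.prems show ?case
    by (intro exI[of _ "\<zeta>(Suc n := z)"]) (auto simp: less_Suc_eq le_Suc_eq z'_def ac_simps)
qed

text \<open>
  Greedy Krylov chains: after \<open>e j\<close> the next basis vector is \<open>u (e j)\<close> if that is independent of the
  vectors so far, and an arbitrary new vector of \<open>I\<close> otherwise. The matrix of \<open>u\<close> in the resulting basis is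
  upper Hessenberg, with a subdiagonal entry 1 and nothing else in the column for each step of the first kind.
\<close>

lemma hessenberg_extension:
  assumes I: "finite S" "span S = I" "\<And>v. v \<in> I \<Longrightarrow> u v \<in> I"
    and e: "inj_on e {..<n}" "independent (e ` {..<n})" "e ` {..<n} \<subseteq> I"
      "\<And>j. Suc j < n \<Longrightarrow> u (e j) \<in> span (e ` {..j}) \<or> u (e j) = e (Suc j)"
  shows "\<exists>e' r. n \<le> r \<and> (\<forall>i<n. e' i = e i) \<and> inj_on e' {..<r} \<and> independent (e' ` {..<r}) \<and>
    span (e' ` {..<r}) = I \<and>
    (\<forall>j<r. u (e' j) \<in> span (e' ` {..j}) \<or> Suc j < r \<and> u (e' j) = e' (Suc j))"
  using e
proof (induction "card S - n" arbitrary: n e rule: less_induct)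
  case less
  have sub: "span (e ` {..<n}) \<subseteq> I"
    using less.prems(3) I(2) by (metis span_minimal subspace_span)
  show ?case
  proof (cases "span (e ` {..<n}) = I")
    case True
    have "u (e j) \<in> span (e ` {..j}) \<or> Suc j < n \<and> u (e j) = e (Suc j)" if "j < n" for j
    proof (cases "Suc j < n")
      case False
      then have "{..<n} = {..j}" using that by auto
      moreover have "u (e j) \<in> I" using less.prems(3) I(3) that by auto
      ultimately show ?thesis using True by auto
    qed (use less.prems(4) in auto)
    then show ?thesis using less.prems True by (intro exI[of _ e] exI[of _ n]) auto
  next
    case False
    define y where "y = (if n > 0 \<and> u (e (n - 1)) \<notin> span (e ` {..<n}) then u (e (n - 1))
      else (SOME y. y \<in> I - span (e ` {..<n})))"
    have "\<exists>y. y \<in> I - span (e ` {..<n})" using False sub by auto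
    moreover have "u (e (n - 1)) \<in> I" if "n > 0"
      using less.prems(3) that by (intro I(3)) auto
    ultimately have y: "y \<in> I" "y \<notin> span (e ` {..<n})"
      using someI_ex[of "\<lambda>y. y \<in> I - span (e ` {..<n})"] by (auto simp: y_def)
    define e' where "e' = e(n := y)"
    have img: "e' ` {..<Suc n} = insert y (e ` {..<n})"
      by (auto simp: e'_def lessThan_Suc)
    have agree: "e' i = e i" if "i < n" for i using that by (simp add: e'_def)
    have imgle: "e' ` {..j} = e ` {..j}" if "j < n" for j using that by (auto simp: e'_def)
    have inj: "inj_on e' {..<Suc n}"
      using less.prems(1) y(2) span_base[of _ "e ` {..<n}"]
      by (force simp: inj_on_def e'_def less_Suc_eq)
    have ind: "independent (e' ` {..<Suc n})"
      unfolding img using y(2) less.prems(2) by (rule independent_insertI)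
    have sub': "e' ` {..<Suc n} \<subseteq> I" unfolding img using y(1) less.prems(3) by auto
    have "card (e' ` {..<Suc n}) \<le> card S"
      using independent_span_bound[OF I(1) ind] sub' I(2) by auto
    then have "Suc n \<le> card S" using card_image[OF inj] by simp
    moreover have "u (e' j) \<in> span (e' ` {..j}) \<or> u (e' j) = e' (Suc j)" if "Suc j < Suc n" for j
    proof (cases "Suc j < n")
      case True
      then show ?thesis using less.prems(4)[OF True] imgle[of j] agree[of j] agree[of "Suc j"] by auto
    next
      case False
      then have n: "n = Suc j" using that by auto
      then have "{..<n} = {..j}" by auto
      then show ?thesis using n imgle[of j] agree[of j] by (auto simp: y_def e'_def)
    qed
    ultimately obtain e'' r where "Suc n \<le> r" "\<forall>i<Suc n. e'' i = e' i" "inj_on e'' {..<r}"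
      "independent (e'' ` {..<r})" "span (e'' ` {..<r}) = I"
      "\<forall>j<r. u (e'' j) \<in> span (e'' ` {..j}) \<or> Suc j < r \<and> u (e'' j) = e'' (Suc j)"
      using less.hyps[OF _ inj ind sub'] by (metis Suc_le_lessD diff_less_mono2 lessI)
    then show ?thesis using agree by (intro exI[of _ e''] exI[of _ r]) auto
  qed
qed

lemma funpow_shift:
  assumes Q: "endomorphism scale Q" "Q (f 0) = 0" "\<And>i. Suc i < n \<Longrightarrow> Q (f (Suc i)) = f i"
    and "i < n"
  shows "(Q ^^ j) (f i) = (if j \<le> i then f (i - j) else 0)"
proof (induction j)
  case (Suc j)
  show ?case
  proof (cases "Suc j \<le> i")
    case True
    then have "i - j = Suc (i - Suc j)" "Suc (i - Suc j) < n" using assms(4) by auto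
    then show ?thesis using Suc.IH True Q(3)[of "i - Suc j"] by simp
  next
    case False
    then show ?thesis using Suc.IH Q(2) by (cases "j \<le> i") (auto simp: endo_zero[OF Q(1)])
  qed
qed auto

lemma sum_const_char_two:
  "finite C \<Longrightarrow> (\<Sum>j\<in>C. v) = (if even (card C) then 0 else (v::'v))"
  by (induction C rule: finite_induct) auto

lemma endo_coordinate:
  assumes "independent B" "span B = UNIV"
  shows "endomorphism scale (\<lambda>v. (t * representation B v b) *s k)"
  using assms by (intro endoI)
    (simp_all add: representation_add representation_scale distrib_left scale_left_distrib mult.left_commute)

text \<open>
  Let \<open>C\<close> be the set of columns with a subdiagonal entry 1. For the shift \<open>Q\<close> of the whole basis,
  the power \<open>Q ^^ j\<close> sends \<open>u (e j)\<close> to its diagonal coefficient times \<open>e 0\<close>, plus \<open>e 1\<close> if \<open>j \<in> C\<close>.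
  Hence the condition left over by \<open>shift_recursion\<close> reads \<open>\<tau> e 0 + card C e 1 = 0\<close>. The term in
  \<open>e 0\<close> is cancelled by the rank-one map with \<open>k = e 0\<close>, and the term in \<open>e 1\<close> vanishes if \<open>card C\<close>
  is even.

  If \<open>card C\<close> is odd, then \<open>Q\<close> fixes \<open>e 0\<close> and shifts only the remaining vectors. The assumption \<open>start\<close>
  now says that \<open>u (e 0) = e 1\<close>. Therefore the remaining diagonal block still has trace \<open>\<tau>\<close>, and it has one
  subdiagonal entry fewer, so the even case applies to it with \<open>k = e 1\<close>. Since \<open>Q\<close> has the eigenvalue 1
  at \<open>e 0\<close> and is nilpotent on the other block, the off-diagonal blocks of \<open>u\<close> are no obstruction.

  The maps are made to vanish on the rest of a basis \<open>B\<close> of the whole space, which keeps them linear everywhere.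
  The normalisation \<open>\<phi> k = 1\<close> is stated as \<open>\<tau> * \<phi> k = \<tau>\<close> in order to include \<open>I = {0}\<close>.
\<close>

lemma commutator_plus_rank_one:
  assumes u: "endomorphism scale u"
    and B: "independent B" "span B = UNIV"
    and e: "inj_on e {..<r}" "e ` {..<r} \<subseteq> B"
    and I: "I = span (e ` {..<r})" "\<And>v. v \<in> I \<Longrightarrow> u v \<in> I"
    and hess: "\<And>j. j < r \<Longrightarrow> u (e j) \<in> span (e ` {..j}) \<or> Suc j < r \<and> u (e j) = e (Suc j)"
    and start: "\<And>j. j < r \<Longrightarrow> u (e j) \<notin> span (e ` {..j}) \<Longrightarrow> 1 < r \<and> u (e 0) = e 1"
    and \<tau>: "\<tau> = (\<Sum>j<r. representation B (u (e j)) (e j))"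
  shows "\<exists>Q Z \<phi> k. endomorphism scale Q \<and> endomorphism scale Z \<and>
    (\<forall>s t v w. \<phi> (s *s v + t *s w) = s * \<phi> v + t * \<phi> w) \<and>
    (\<forall>v. Q v \<in> I \<and> Z v \<in> I) \<and> (\<forall>b\<in>B - e ` {..<r}. Q b = 0 \<and> Z b = 0 \<and> \<phi> b = 0) \<and>
    k \<in> I \<and> Q k = 0 \<and> \<tau> * \<phi> k = \<tau> \<and>
    (\<forall>v\<in>I. u v = Q (Z v) + Z (Q v) + (\<tau> * \<phi> v) *s k)"
proof -
  define crd where "crd m v = representation B v (e m)" for m v
  have crd_lin: "crd m (s *s v + t *s w) = s * crd m v + t * crd m w" for m s t v w
    by (simp add: crd_def B representation_add representation_scale)
  have crd_endo: "endomorphism scale (\<lambda>v. (t * crd m v) *s k)" for t m k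
    unfolding crd_def by (rule endo_coordinate[OF B])
  have crd_e: "crd m (e j) = (if j = m then 1 else 0)" if "j < r" "m < r" for m j
  proof -
    have "e j \<in> B" using that(1) e(2) by auto
    then show ?thesis
      using that inj_onD[OF e(1), of j m] by (auto simp: crd_def representation_basis[OF B(1)])
  qed
  have crd_out: "crd m b = 0" if "b \<in> B - e ` {..<r}" "m < r" for b m
  proof -
    have "b \<in> B" "b \<noteq> e m" using that by auto
    then show ?thesis by (simp add: crd_def representation_basis[OF B(1)])
  qed
  have I_sub: "subspace I" using I(1) by simp
  have eI: "e j \<in> I" if "j < r" for j using that I(1) span_base by auto
  have from_e: "\<exists>f. endomorphism scale f \<and> (\<forall>j<r. f (e j) = q j) \<and>
      (\<forall>b\<in>B - e ` {..<r}. f b = 0) \<and> (\<forall>v. f v \<in> I)" if q: "\<And>j. j < r \<Longrightarrow> q j \<in> I" for q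
  proof -
    obtain f where f: "endomorphism scale f"
      "\<And>b. b \<in> B \<Longrightarrow> f b = (if b \<in> e ` {..<r} then q (inv_into {..<r} e b) else 0)"
      using endo_from_basis[OF B, of "\<lambda>b. if b \<in> e ` {..<r} then q (inv_into {..<r} e b) else 0"] by auto
    have fe: "f (e j) = q j" if "j < r" for j
    proof -
      have "e j \<in> B" "e j \<in> e ` {..<r}" using that e(2) by auto
      then show ?thesis using that by (simp add: f(2) inv_into_f_f[OF e(1)])
    qed
    have out: "f b = 0" if "b \<in> B - e ` {..<r}" for b
      using that by (simp add: f(2))
    have "f b \<in> I" if "b \<in> B" for b
      using fe q out[of b] that subspace_0[OF I_sub] by (cases "b \<in> e ` {..<r}") auto
    then have "f v \<in> I" for v
      by (rule endo_into_span[OF f(1) B(2) I_sub])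
    then show ?thesis using f(1) fe out by (intro exI[of _ f]) simp
  qed
  define C where "C = {j. j < r \<and> u (e j) \<notin> span (e ` {..j})}"
  have chain: "Suc j < r" "u (e j) = e (Suc j)" if "j \<in> C" for j
    using that hess[of j] by (auto simp: C_def)
  have finC: "finite C" by (simp add: C_def)
  consider (zero) "r = 0" | (even) "r > 0" "even (card C)" | (odd) "odd (card C)" by auto
  then show ?thesis
  proof cases
    case zero
    have "I = {0}" "\<tau> = 0" using zero I(1) \<tau> by auto
    then show ?thesis
      by (intro exI[of _ "\<lambda>_. 0"] exI[of _ 0])
        (auto intro!: endoI simp: I(2)[of 0, simplified] endo_zero[OF u])
  next
    case even
    then obtain n where r: "r = Suc n" by (auto dest: gr0_implies_Suc)
    have "(if j = 0 then 0 else e (j - 1)) \<in> I" if "j < r" for j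
      using that eI subspace_0[OF I_sub] by auto
    from from_e[of "\<lambda>j. if j = 0 then 0 else e (j - 1)", OF this] obtain Q where Q: "endomorphism scale Q"
      "\<And>j. j < r \<Longrightarrow> Q (e j) = (if j = 0 then 0 else e (j - 1))"
      "\<And>b. b \<in> B - e ` {..<r} \<Longrightarrow> Q b = 0" "\<And>v. Q v \<in> I"
      by blast
    have Q0: "Q (e 0) = 0" and QS: "\<And>i. Suc i < r \<Longrightarrow> Q (e (Suc i)) = e i"
      using Q(2)[of 0] Q(2)[of "Suc _"] r by auto
    note pow = funpow_shift[where f = e and n = r, OF Q(1) Q0 QS]
    have low: "(Q ^^ j) y = crd j y *s e 0" if "j < r" "y \<in> span (e ` {..j})" for j y
    proof -
      have "(Q ^^ j) y = (1 * crd j y) *s e 0"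
        using that by (intro pair.linear_eq_on[OF endo_funpow[OF Q(1)] crd_endo that(2)])
          (auto simp: pow crd_e)
      then show ?thesis by simp
    qed
    have each: "(Q ^^ j) (u (e j)) = crd j (u (e j)) *s e 0 + (if j \<in> C then e 1 else 0)" if "j < r" for j
      using that chain[of j] low[of j "u (e j)"] by (auto simp: C_def pow crd_e)
    define G where "G j = u (e j) + (\<tau> * crd 0 (e j)) *s e 0" for j
    have G: "G j = (if j = 0 then u (e 0) + \<tau> *s e 0 else u (e j))" if "j < r" for j
      using that r by (auto simp: G_def crd_e)
    have "(\<Sum>j\<le>n. (Q ^^ j) (G j)) = (\<Sum>j<r. (Q ^^ j) (u (e j)) + (if j = 0 then \<tau> *s e 0 else 0))"
      unfolding r lessThan_Suc_atMost by (rule sum.cong) (auto simp: G r)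
    also have "\<dots> = (\<Sum>j<r. crd j (u (e j))) *s e 0 + (\<Sum>j\<in>C. e 1) + \<tau> *s e 0"
    proof -
      have "(\<Sum>j<r. if j \<in> C then e 1 else 0) = (\<Sum>j\<in>C. e 1)"
        by (rule sum.mono_neutral_cong_right) (auto simp: C_def)
      then show ?thesis using even(1) by (simp add: sum.distrib each scale_sum_left sum.delta)
    qed
    also have "\<dots> = 0"
      using even(2) sum_const_char_two[OF finC] \<tau> by (simp add: crd_def ac_simps)
    finally have sum0: "(\<Sum>j\<le>n. (Q ^^ j) (G j)) = 0" .
    have GI: "G j \<in> I" if "j \<le> n" for j
      using that G[of j] r I(2) eI by (auto intro!: subspace_add[OF I_sub] subspace_scale[OF I_sub])
    have "\<exists>\<zeta>. (\<forall>i\<le>n. \<zeta> i \<in> I) \<and> \<zeta> n = 0 \<and> (\<forall>i<n. Q (\<zeta> (Suc i)) + \<zeta> i = G (Suc i)) \<and>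
        Q (\<zeta> 0) + G 0 = (Q ^^ Suc n) 0 + (\<Sum>j\<le>n. (Q ^^ j) (G j))"
      by (rule shift_recursion[OF Q(1) I_sub]) (use Q(4) GI subspace_0[OF I_sub] in simp_all)
    then obtain \<zeta> where rec: "(\<forall>i\<le>n. \<zeta> i \<in> I) \<and> \<zeta> n = 0 \<and>
        (\<forall>i<n. Q (\<zeta> (Suc i)) + \<zeta> i = G (Suc i)) \<and>
        Q (\<zeta> 0) + G 0 = (Q ^^ Suc n) 0 + (\<Sum>j\<le>n. (Q ^^ j) (G j))" ..
    have \<zeta>: "\<forall>i\<le>n. \<zeta> i \<in> I" "\<forall>i<n. Q (\<zeta> (Suc i)) + \<zeta> i = G (Suc i)"
      "Q (\<zeta> 0) + G 0 = (Q ^^ Suc n) 0 + (\<Sum>j\<le>n. (Q ^^ j) (G j))"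
      using rec by blast+
    have \<zeta>0: "Q (\<zeta> 0) = G 0"
      using \<zeta>(3) by (simp only: endo_zero[OF endo_funpow[OF Q(1)]] sum0 add_0 flip: eq_iff_sum_zero)
    have "\<zeta> j \<in> I" if "j < r" for j using that r \<zeta>(1) by auto
    from from_e[of "\<zeta>", OF this] obtain Z where Z: "endomorphism scale Z" "\<And>j. j < r \<Longrightarrow> Z (e j) = \<zeta> j"
      "\<And>b. b \<in> B - e ` {..<r} \<Longrightarrow> Z b = 0" "\<And>v. Z v \<in> I"
      by blast
    have "u v = Q (Z v) + Z (Q v) + (\<tau> * crd 0 v) *s e 0" if "v \<in> I" for v
    proof (rule pair.linear_eq_on[OF u _ that[unfolded I(1)]])
      show "endomorphism scale (\<lambda>v. Q (Z v) + Z (Q v) + (\<tau> * crd 0 v) *s e 0)"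
        by (intro endoI) (simp_all add: Q(1) Z(1) endo_add endo_scale endo_add[OF crd_endo]
            endo_scale[OF crd_endo] scale_right_distrib ac_simps)
      fix b assume "b \<in> e ` {..<r}"
      then obtain j where j: "j < r" "b = e j" by auto
      show "u b = Q (Z b) + Z (Q b) + (\<tau> * crd 0 b) *s e 0"
      proof (cases j)
        case 0
        then show ?thesis using j \<zeta>0 Z(2) Q0 G[of 0] by (simp add: endo_zero[OF Z(1)] crd_e add.assoc)
      next
        case (Suc i)
        then show ?thesis using j \<zeta>(2) Z(2) QS G[of j] r by (simp add: crd_e)
      qed
    qed
    then show ?thesis
      using Q Z crd_lin crd_out[of _ 0] eI[of 0] Q0 crd_e[of 0 0] r
      by (intro exI[of _ Q] exI[of _ Z] exI[of _ "crd 0"] exI[of _ "e 0"]) auto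
  next
    case odd
    then have "C \<noteq> {}" by auto
    then obtain j where "j < r" "u (e j) \<notin> span (e ` {..j})" by (auto simp: C_def)
    then have r1: "1 < r" and u0: "u (e 0) = e 1" using start by auto
    then obtain n where r: "r = Suc (Suc n)" by (metis One_nat_def less_imp_Suc_add add_Suc_shift plus_1_eq_Suc add_Suc)
    have e01: "crd 0 (e 1) = 0" "crd 1 (e 0) = 0" using crd_e r1 by auto
    have "(if j = 0 then e 0 else if j = 1 then 0 else e (j - 1)) \<in> I" if "j < r" for j
      using that eI subspace_0[OF I_sub] by auto
    from from_e[of "\<lambda>j. if j = 0 then e 0 else if j = 1 then 0 else e (j - 1)", OF this] obtain Q where Q: "endomorphism scale Q"
      "\<And>j. j < r \<Longrightarrow> Q (e j) = (if j = 0 then e 0 else if j = 1 then 0 else e (j - 1))"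
      "\<And>b. b \<in> B - e ` {..<r} \<Longrightarrow> Q b = 0" "\<And>v. Q v \<in> I"
      by blast
    define f where "f i = e (Suc i)" for i
    have Q0: "Q (e 0) = e 0" using Q(2)[of 0] r by auto
    have Qf0: "Q (f 0) = 0" and QfS: "\<And>i. Suc i < Suc n \<Longrightarrow> Q (f (Suc i)) = f i"
      using Q(2)[of 1] Q(2)[of "Suc (Suc _)"] r by (auto simp: f_def)
    have pow0: "(Q ^^ j) (e 0) = e 0" for j by (induction j) (auto simp: Q0)
    note pow = funpow_shift[where f = f and n = "Suc n", OF Q(1) Qf0 QfS]
    have low: "(Q ^^ j) y = crd (Suc j) y *s f 0 + crd 0 y *s e 0"
      if "j \<le> n" "y \<in> span (e ` {..Suc j})" for j y
    proof -
      have "(Q ^^ j) y = (1 * crd (Suc j) y) *s f 0 + (1 * crd 0 y) *s e 0"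
      proof (rule pair.linear_eq_on[OF endo_funpow[OF Q(1)] _ that(2)])
        show "endomorphism scale (\<lambda>y. (1 * crd (Suc j) y) *s f 0 + (1 * crd 0 y) *s e 0)"
          by (intro endoI) (simp_all only: endo_add[OF crd_endo]
            endo_scale[OF crd_endo] scale_right_distrib ac_simps)
        fix b assume "b \<in> e ` {..Suc j}"
        then obtain i where i: "i \<le> Suc j" "b = e i" by auto
        show "(Q ^^ j) b = (1 * crd (Suc j) b) *s f 0 + (1 * crd 0 b) *s e 0"
        proof (cases i)
          case 0
          then show ?thesis using i that r by (simp add: pow0 crd_e)
        next
          case (Suc i')
          then show ?thesis using i that r pow[of i' j] by (auto simp: crd_e f_def)
        qed
      qed
      then show ?thesis by simp
    qed
    have each: "(Q ^^ j) (u (f j)) = crd (Suc j) (u (f j)) *s f 0 + crd 0 (u (f j)) *s e 0 +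
        (if Suc j \<in> C then f 1 else 0)" if "j \<le> n" for j
    proof (cases "Suc j \<in> C")
      case True
      have "u (f j) = f (Suc j)" "Suc (Suc j) < r" using chain[OF True] by (simp_all add: f_def)
      then show ?thesis using True that r pow[of "Suc j" j] by (simp add: crd_e f_def)
    next
      case False
      then show ?thesis using that r low[OF that, of "u (f j)"] by (auto simp: C_def f_def)
    qed
    define G where "G j = u (f j) + (\<tau> * crd 1 (f j)) *s f 0" for j
    have G: "G j = (if j = 0 then u (f 0) + \<tau> *s f 0 else u (f j))" if "j \<le> n" for j
      using that r by (auto simp: G_def f_def crd_e)
    (* The first row of u contributes multiples of e 0, which Q fixes; the free last value
       z = \<rho> e 0 of the recursion absorbs their sum. *)
    define \<rho> where "\<rho> = (\<Sum>j\<le>n. crd 0 (u (f j)))"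
    have tr: "(\<Sum>j\<le>n. crd (Suc j) (u (f j))) = \<tau>"
      unfolding \<tau> r lessThan_Suc_atMost
      by (subst sum.atMost_Suc_shift) (use u0 e01 in \<open>simp add: crd_def f_def\<close>)
    have evenC: "(\<Sum>j\<le>n. if Suc j \<in> C then f 1 else 0) = 0"
    proof -
      define C' where "C' = {j. Suc j \<in> C}"
      have "e 1 \<notin> span {e 0}"
      proof
        assume "e 1 \<in> span {e 0}"
        moreover have "endomorphism scale (\<lambda>v. (1 * crd 1 v) *s e 1)" by (rule crd_endo)
        ultimately have "(1 * crd 1 (e 1)) *s e 1 = 0"
          by (rule pair.linear_eq_0_on_span[rotated -1]) (use e01 in simp)
        then have "e 1 = 0" using crd_e[OF r1 r1] by simp
        moreover have "e 1 \<in> B" using e(2) r1 by auto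
        ultimately show False using B(1) dependent_zero by auto
      qed
      then have c0: "0 \<in> C" using u0 r by (simp add: C_def)
      have C: "C = insert 0 (Suc ` C')"
        using c0
      proof (intro set_eqI)
        fix i show "i \<in> C \<longleftrightarrow> i \<in> insert 0 (Suc ` C')"
          using c0 by (cases i) (auto simp: C'_def)
      qed
      have finC': "finite C'" using finC unfolding C by (simp add: finite_image_iff)
      then have "card C = Suc (card C')" unfolding C by (simp add: card_image)
      then have "even (card C')" using odd by simp
      moreover have "(\<Sum>j\<le>n. if Suc j \<in> C then f 1 else 0) = (\<Sum>j\<in>C'. f 1)"
        by (rule sum.mono_neutral_cong_right) (auto simp: C_def C'_def r)
      ultimately show ?thesis using sum_const_char_two[OF finC'] by simp
    qed
    have "(\<Sum>j\<le>n. (Q ^^ j) (G j)) = (\<Sum>j\<le>n. (Q ^^ j) (u (f j)) + (if j = 0 then \<tau> *s f 0 else 0))"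
      by (rule sum.cong) (auto simp: G)
    also have "\<dots> = (\<Sum>j\<le>n. crd (Suc j) (u (f j))) *s f 0 + \<rho> *s e 0 + \<tau> *s f 0"
      by (simp add: sum.distrib each scale_sum_left sum.delta evenC \<rho>_def)
    also have "\<dots> = \<rho> *s e 0" by (simp add: tr ac_simps)
    finally have sum\<rho>: "(\<Sum>j\<le>n. (Q ^^ j) (G j)) = \<rho> *s e 0" .
    have GI: "G j \<in> I" if "j \<le> n" for j
      using that G[of j] r I(2) eI
      by (auto intro!: subspace_add[OF I_sub] subspace_scale[OF I_sub] simp: f_def)
    have \<rho>I: "\<rho> *s e 0 \<in> I" using eI[of 0] r subspace_scale[OF I_sub] by auto
    have "\<exists>\<zeta>. (\<forall>i\<le>n. \<zeta> i \<in> I) \<and> \<zeta> n = \<rho> *s e 0 \<and>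
        (\<forall>i<n. Q (\<zeta> (Suc i)) + \<zeta> i = G (Suc i)) \<and>
        Q (\<zeta> 0) + G 0 = (Q ^^ Suc n) (\<rho> *s e 0) + (\<Sum>j\<le>n. (Q ^^ j) (G j))"
      by (rule shift_recursion[OF Q(1) I_sub]) (use Q(4) GI \<rho>I in simp_all)
    then obtain \<zeta> where rec: "(\<forall>i\<le>n. \<zeta> i \<in> I) \<and> \<zeta> n = \<rho> *s e 0 \<and>
        (\<forall>i<n. Q (\<zeta> (Suc i)) + \<zeta> i = G (Suc i)) \<and>
        Q (\<zeta> 0) + G 0 = (Q ^^ Suc n) (\<rho> *s e 0) + (\<Sum>j\<le>n. (Q ^^ j) (G j))" ..
    have \<zeta>: "\<forall>i\<le>n. \<zeta> i \<in> I" "\<forall>i<n. Q (\<zeta> (Suc i)) + \<zeta> i = G (Suc i)"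
      "Q (\<zeta> 0) + G 0 = (Q ^^ Suc n) (\<rho> *s e 0) + (\<Sum>j\<le>n. (Q ^^ j) (G j))"
      using rec by blast+
    have \<zeta>0: "Q (\<zeta> 0) = G 0"
      using \<zeta>(3) by (simp only: sum\<rho> pow0 endo_scale[OF endo_funpow[OF Q(1)]] double_zero flip: eq_iff_sum_zero)
    (* Q kills e 1, so the equation at e 0 is Q (Z (e 0)) + Z (e 0) = e 1, with solution e 1. *)
    define \<xi> where "\<xi> j = (case j of 0 \<Rightarrow> e 1 | Suc i \<Rightarrow> \<zeta> i)" for j
    have "\<xi> j \<in> I" if "j < r" for j using that r \<zeta>(1) eI[of 1] by (cases j) (auto simp: \<xi>_def)
    from from_e[of "\<xi>", OF this] obtain Z where Z: "endomorphism scale Z" "\<And>j. j < r \<Longrightarrow> Z (e j) = \<xi> j"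
      "\<And>b. b \<in> B - e ` {..<r} \<Longrightarrow> Z b = 0" "\<And>v. Z v \<in> I"
      by blast
    have "u v = Q (Z v) + Z (Q v) + (\<tau> * crd 1 v) *s e 1" if "v \<in> I" for v
    proof (rule pair.linear_eq_on[OF u _ that[unfolded I(1)]])
      show "endomorphism scale (\<lambda>v. Q (Z v) + Z (Q v) + (\<tau> * crd 1 v) *s e 1)"
        by (intro endoI) (simp_all add: Q(1) Z(1) endo_add endo_scale endo_add[OF crd_endo]
            endo_scale[OF crd_endo] scale_right_distrib ac_simps)
      fix b assume "b \<in> e ` {..<r}"
      then obtain j where j: "j < r" "b = e j" by auto
      consider "j = 0" | "j = 1" | i where "j = Suc (Suc i)" by (metis One_nat_def not0_implies_Suc)
      then show "u b = Q (Z b) + Z (Q b) + (\<tau> * crd 1 b) *s e 1"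
      proof cases
        case 1
        then show ?thesis using j u0 Z(2)[of 0] Q0 Qf0 e01 by (simp add: \<xi>_def f_def)
      next
        case 2
        then show ?thesis using j \<zeta>0 Z(2)[of 1] Qf0 G[of 0] r1
          by (simp add: endo_zero[OF Z(1)] crd_e f_def \<xi>_def add.assoc)
      next
        case (3 i)
        then show ?thesis using j \<zeta>(2) Z(2) QfS[of i] G[of "Suc i"] r by (simp add: crd_e f_def \<xi>_def)
      qed
    qed
    then show ?thesis
      using Q Z crd_lin crd_out[of _ 1] eI[of 1] Qf0 crd_e[of 1 1] r1
      by (intro exI[of _ Q] exI[of _ Z] exI[of _ "crd 1"] exI[of _ "e 1"]) (auto simp: f_def)
  qed
qed

section \<open>The decomposition of the space\<close>

text \<open>
  The basis \<open>B\<close> is cut into \<open>E\<close> (a basis of the image), \<open>J\<close>, a copy \<open>\<kappa> ` E\<close>, a copy \<open>t ` J\<close>, and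
  possibly one more vector \<open>l\<close>; if there is none, the convention \<open>l = 0\<close> lets the same formulas serve
  both cases. Here \<open>U\<close> is spanned by \<open>E\<close> and \<open>t ` J\<close>, and \<open>U'\<close> by \<open>\<kappa> ` E\<close>, \<open>J\<close> and \<open>l\<close>.

  Two changes of basis by involutions bring \<open>u\<close> into the required form. Let \<open>c\<close> be a linear map into the
  image that vanishes on the span of \<open>B0\<close>. As \<open>\<sigma>\<close> is a section of \<open>u\<close> with values in that span, conjugation
  by \<open>\<Phi> = 1 + \<sigma> c\<close> turns \<open>u\<close> into \<open>u + c\<close>. So the values on basis vectors outside \<open>B0\<close>, where \<open>u\<close>
  vanishes, can be prescribed at will. Conjugation by \<open>\<Psi> = 1 + h\<close> then replaces each \<open>b\<close> in \<open>E\<close> by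
  \<open>b + \<kappa> (Q b) + \<phi> (b) l\<close>. The values of \<open>c\<close> are such that \<open>(u + c) \<Psi>\<close> sends \<open>b\<close> to
  \<open>u b + Z (Q b) + \<tau> \<phi> (b) k = Q (Z b)\<close>, and the images of \<open>t j\<close> and \<open>b\<close> in \<open>U\<close> match those of
  \<open>j\<close> and \<open>\<kappa> b\<close> in \<open>U'\<close>, up to multiples of \<open>l\<close>.
\<close>

lemma three_square_zero_of_model:
  assumes u: "endomorphism scale u" and B: "independent B" "span B = UNIV"
    and I: "E \<subseteq> B0" "\<And>v. u v \<in> span E"
    and ker: "\<And>b. b \<in> B - B0 \<Longrightarrow> u b = 0"
    and \<sigma>: "endomorphism scale \<sigma>" "\<And>y. y \<in> span E \<Longrightarrow> u (\<sigma> y) = y"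
      "\<And>y. y \<in> span E \<Longrightarrow> \<sigma> y \<in> span B0"
    and QZ: "endomorphism scale Q" "endomorphism scale Z" "\<And>v. Q v \<in> span E" "\<And>v. Z v \<in> span E"
      "\<And>b. b \<in> B - E \<Longrightarrow> Q b = 0 \<and> Z b = 0 \<and> \<phi> b = 0"
    and \<phi>: "\<And>s t v w. \<phi> (s *s v + t *s w) = s * \<phi> v + t * \<phi> w"
    and k: "k \<in> span E" "Q k = 0" "\<tau> * \<phi> k = \<tau>"
    and comm: "\<And>v. v \<in> span E \<Longrightarrow> u v = Q (Z v) + Z (Q v) + (\<tau> * \<phi> v) *s k"
    and parts: "B = E \<union> J \<union> \<kappa> ` E \<union> L \<union> t ` J" "inj_on \<kappa> E" "inj_on t J"
      "E \<inter> J = {}" "(E \<union> J) \<inter> \<kappa> ` E = {}" "(E \<union> J \<union> \<kappa> ` E) \<inter> L = {}"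
      "(E \<union> J \<union> \<kappa> ` E \<union> L) \<inter> t ` J = {}" "B0 \<subseteq> E \<union> J"
    and L: "L = {l} \<and> \<tau> = \<alpha> \<or> L = {} \<and> l = 0 \<and> \<tau> = 0"
  shows "three_square_zero (\<lambda>v. \<alpha> *s v + u v)"
proof -
  have from_parts: "\<exists>f. endomorphism scale f \<and> (\<forall>b\<in>E. f b = gE b \<and> f (\<kappa> b) = g\<kappa> b) \<and>
      (\<forall>j\<in>J. f j = gJ j \<and> f (t j) = gt j) \<and> (\<forall>b\<in>L. f b = gL)" for gE g\<kappa> gJ gt gL
  proof -
    define g where "g b = (if b \<in> E then gE b else if b \<in> J then gJ b else
      if b \<in> \<kappa> ` E then g\<kappa> (inv_into E \<kappa> b) else if b \<in> L then gL else gt (inv_into J t b))" for b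
    have "g b = gE b" "g (\<kappa> b) = g\<kappa> b" if "b \<in> E" for b
      using that parts by (auto simp: g_def inv_into_f_f disjoint_iff)
    moreover have "g j = gJ j" "g (t j) = gt j" if "j \<in> J" for j
      using that parts by (auto simp: g_def inv_into_f_f disjoint_iff)
    moreover have "g b = gL" if "b \<in> L" for b
      using that parts by (auto simp: g_def disjoint_iff)
    ultimately show ?thesis
      using endo_from_basis[OF B, of g] parts(1) by auto
  qed
  have basis_eq: "f v = g v" if "endomorphism scale f" "endomorphism scale g"
    "\<And>b. b \<in> E \<Longrightarrow> f b = g b" "\<And>b. b \<in> E \<Longrightarrow> f (\<kappa> b) = g (\<kappa> b)"
    "\<And>j. j \<in> J \<Longrightarrow> f j = g j" "\<And>j. j \<in> J \<Longrightarrow> f (t j) = g (t j)"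
    "\<And>b. b \<in> L \<Longrightarrow> f b = g b" for f g v
    by (rule endo_eq_on_basis[OF that(1,2) B(2)]) (use that parts(1) in auto)
  obtain \<iota> where \<iota>: "endomorphism scale \<iota>" "\<And>b. b \<in> E \<Longrightarrow> \<iota> b = \<kappa> b" "\<And>b. b \<in> E \<Longrightarrow> \<iota> (\<kappa> b) = 0"
    "\<And>j. j \<in> J \<Longrightarrow> \<iota> j = 0" "\<And>j. j \<in> J \<Longrightarrow> \<iota> (t j) = 0" "\<And>b. b \<in> L \<Longrightarrow> \<iota> b = 0"
    using from_parts[of \<kappa> "\<lambda>_. 0" "\<lambda>_. 0" "\<lambda>_. 0" 0] by auto
  obtain c where c: "endomorphism scale c" "\<And>b. b \<in> E \<Longrightarrow> c b = 0" "\<And>b. b \<in> E \<Longrightarrow> c (\<kappa> b) = Z b"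
    "\<And>j. j \<in> J \<Longrightarrow> c j = 0" "\<And>j. j \<in> J \<Longrightarrow> c (t j) = Q (u j)" "\<And>b. b \<in> L \<Longrightarrow> c b = \<tau> *s k"
    using from_parts[of "\<lambda>_. 0" Z "\<lambda>_. 0" "\<lambda>j. Q (u j)" "\<tau> *s k"] by auto
  obtain x where x: "endomorphism scale x" "\<And>b. b \<in> E \<Longrightarrow> x b = 0" "\<And>b. b \<in> E \<Longrightarrow> x (\<kappa> b) = b"
    "\<And>j. j \<in> J \<Longrightarrow> x j = t j" "\<And>j. j \<in> J \<Longrightarrow> x (t j) = 0" "\<And>b. b \<in> L \<Longrightarrow> x b = 0"
    using from_parts[of "\<lambda>_. 0" "\<lambda>b. b" t "\<lambda>j. 0" 0] by auto
  obtain \<pi> where \<pi>: "endomorphism scale \<pi>" "\<And>b. b \<in> E \<Longrightarrow> \<pi> b = b" "\<And>b. b \<in> E \<Longrightarrow> \<pi> (\<kappa> b) = 0"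
    "\<And>j. j \<in> J \<Longrightarrow> \<pi> j = 0" "\<And>j. j \<in> J \<Longrightarrow> \<pi> (t j) = t j" "\<And>b. b \<in> L \<Longrightarrow> \<pi> b = 0"
    using from_parts[of "\<lambda>b. b" "\<lambda>_. 0" "\<lambda>_. 0" t 0] by auto
  define h where "h v = \<iota> (Q v) + \<phi> v *s l" for v
  obtain w where w: "endomorphism scale w" "\<And>b. b \<in> E \<Longrightarrow> w b = \<alpha> *s \<kappa> b + h (Z b)"
    "\<And>b. b \<in> E \<Longrightarrow> w (\<kappa> b) = 0"
    "\<And>j. j \<in> J \<Longrightarrow> w j = 0" "\<And>j. j \<in> J \<Longrightarrow> w (t j) = \<alpha> *s j + h (u j)" "\<And>b. b \<in> L \<Longrightarrow> w b = 0"
    using from_parts[of "\<lambda>b. \<alpha> *s \<kappa> b + h (Z b)" "\<lambda>_. 0" "\<lambda>_. 0" "\<lambda>j. \<alpha> *s j + h (u j)" 0] by auto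
  have \<phi>_add: "\<phi> (v + w) = \<phi> v + \<phi> w" and \<phi>_scale: "\<phi> (s *s v) = s * \<phi> v" for v w s
    using \<phi>[of 1 v 1 w] \<phi>[of s v 0 0] by simp_all
  have h: "endomorphism scale h"
    by (intro endoI) (simp_all add: h_def \<phi>_add \<phi>_scale \<iota>(1) QZ(1) endo_add endo_scale
        scale_left_distrib scale_right_distrib ac_simps)
  note lins = u \<sigma>(1) QZ(1,2) \<iota>(1) c(1) x(1) \<pi>(1) w(1) h
  note adds = lins[THEN endo_add] and scales = lins[THEN endo_scale] and zeros = lins[THEN endo_zero]
  have id: "endomorphism scale (\<lambda>v. v)" and zero: "endomorphism scale (\<lambda>v. 0)"
    by (auto intro: endoI)
  have comp: "endomorphism scale (\<lambda>v. f (g v))"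
    if "endomorphism scale f" "endomorphism scale g" for f g
    using that by (intro endoI) (simp_all add: endo_add endo_scale)
  have plus: "endomorphism scale (\<lambda>v. f v + g v)"
    if "endomorphism scale f" "endomorphism scale g" for f g
    using that by (intro endoI) (simp_all add: endo_add endo_scale scale_right_distrib ac_simps)

  have EJ: "E \<subseteq> B" "J \<subseteq> B" "\<And>b. b \<in> E \<Longrightarrow> \<kappa> b \<in> B - B0" "\<And>b. b \<in> E \<Longrightarrow> \<kappa> b \<in> B - E"
    "J \<subseteq> B - E" "L \<subseteq> B - B0" "L \<subseteq> B - E" "\<And>j. j \<in> J \<Longrightarrow> t j \<in> B - B0" "\<And>j. j \<in> J \<Longrightarrow> t j \<in> B - E"
    using parts by (auto simp: disjoint_iff)
  have on_span: "f v = g v" if "v \<in> span E" "endomorphism scale f" "endomorphism scale g"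
    "\<And>b. b \<in> E \<Longrightarrow> f b = g b" for f g v
    using pair.linear_eq_on[OF that(2,3,1,4)] .
  have l: "\<iota> l = 0" "x l = 0" "\<pi> l = 0" "u l = 0" "c l = \<tau> *s k" "h l = 0"
    using L \<iota>(6)[of l] x(6)[of l] \<pi>(6)[of l] c(6)[of l] ker[of l] EJ(6,7) QZ(5)[of l] \<phi>_scale[of 0 0]
    by (auto simp: zeros h_def)
  have c0: "c v = 0" if "v \<in> span B0" for v
    by (rule pair.linear_eq_0_on_span[OF c(1) _ that]) (use c(2,4) parts(8) in auto)
  have E_B0: "v \<in> span B0" if "v \<in> span E" for v using that span_mono[OF I(1)] by auto
  have on_I: "u (\<iota> y) = 0" "c (\<iota> y) = Z y" "\<pi> y = y" "x y = 0" "\<pi> (\<iota> y) = 0" "x (\<iota> y) = y"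
     "h (\<iota> y) = 0" "c y = 0" "c (\<sigma> y) = 0" if y: "y \<in> span E" for y
  proof -
    show "u (\<iota> y) = 0" by (rule on_span[OF y comp[OF u \<iota>(1)] zero]) (simp add: \<iota> ker[OF EJ(3)])
    show "c (\<iota> y) = Z y" by (rule on_span[OF y comp[OF c(1) \<iota>(1)] QZ(2)]) (simp add: \<iota> c)
    show "\<pi> y = y" by (rule on_span[OF y \<pi>(1) id]) (simp add: \<pi>)
    show "x y = 0" by (rule on_span[OF y x(1) zero]) (simp add: x)
    show "\<pi> (\<iota> y) = 0" by (rule on_span[OF y comp[OF \<pi>(1) \<iota>(1)] zero]) (simp add: \<iota> \<pi>)
    show "x (\<iota> y) = y" by (rule on_span[OF y comp[OF x(1) \<iota>(1)] id]) (simp add: \<iota> x)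
    show "h (\<iota> y) = 0"
      by (rule on_span[OF y comp[OF h \<iota>(1)] zero]) (simp add: \<iota> h_def QZ(5)[OF EJ(4)] zeros)
    show "c y = 0" using c0 E_B0 y by auto
    show "c (\<sigma> y) = 0" using c0 \<sigma>(3) y by auto
  qed
  have c_in: "c v \<in> span E" for v
    by (rule endo_into_span[OF c(1) B(2) subspace_span])
      (use parts(1) c QZ(3,4) k(1) in \<open>auto simp: span_zero span_scale\<close>)
  have h_out: "h b = 0" if "b \<in> B - E" for b
    using QZ(5)[OF that] by (simp add: h_def zeros)
  have hh: "h (h v) = 0" for v
    by (simp add: h_def[of v] adds scales on_I QZ(3) l)
  have \<pi>h: "\<pi> (h v) = 0" for v
    by (simp add: h_def[of v] adds scales on_I QZ(3) l)
  have xh: "x (h v) = Q v" for v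
    by (simp add: h_def[of v] adds scales on_I QZ(3) l)

  (* C is (u + c) (1 + h), and M = \<alpha> + (1 + h) C is the conjugate of \<alpha> + u. *)
  define C where "C v = u (v + h v) + c (v + h v)" for v
  define M where "M v = \<alpha> *s v + (C v + h (C v))" for v
  have C_lin: "endomorphism scale C"
    by (intro endoI) (simp_all add: C_def adds scales scale_right_distrib ac_simps)
  have M_lin: "endomorphism scale M"
    by (intro endoI) (simp_all add: M_def adds scales C_lin[THEN endo_add] C_lin[THEN endo_scale]
        scale_right_distrib ac_simps)
  have C_E: "C b = Q (Z b)" if "b \<in> E" for b
  proof -
    have b: "b \<in> span E" using that span_base by auto
    show ?thesis
      by (simp add: C_def h_def adds scales on_I QZ(3) l b comm ac_simps mult.commute)
  qed
  have C_J: "C j = u j" if "j \<in> J" for j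
    using that EJ(5) h_out[of j] by (auto simp: C_def c)
  have C_\<kappa>: "C (\<kappa> b) = Z b" if "b \<in> E" for b
    using that h_out[OF EJ(4)] ker[OF EJ(3)] by (simp add: C_def c)
  have C_L: "C b = \<tau> *s k" if "b \<in> L" for b
  proof -
    have "b \<in> B - E" "b \<in> B - B0" using that EJ(6,7) by auto
    then show ?thesis using that by (simp add: C_def c h_out ker)
  qed
  have C_t: "C (t j) = Q (u j)" if "j \<in> J" for j
    using that h_out[OF EJ(9)] ker[OF EJ(8)] by (simp add: C_def c)
  have hk: "\<tau> *s h k = \<tau> *s l"
    by (simp add: h_def k zeros)

  have v\<pi>: "endomorphism scale (\<lambda>v. v + \<pi> v)" by (rule plus[OF id \<pi>(1)])
  have "three_square_zero M"
  proof (rule three_square_zero_of_blocks[OF M_lin \<pi>(1) x(1) w(1)])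
    fix v
    show "\<pi> (\<pi> v) = \<pi> v"
      by (rule basis_eq[OF comp[OF \<pi>(1) \<pi>(1)] \<pi>(1)]) (simp_all add: \<pi> zeros)
    show "\<pi> (x v) = x v"
      by (rule basis_eq[OF comp[OF \<pi>(1) x(1)] x(1)]) (simp_all add: \<pi> x zeros)
    show "x (\<pi> v) = 0"
      by (rule basis_eq[OF comp[OF x(1) \<pi>(1)] zero]) (simp_all add: \<pi> x zeros)
    show "\<pi> (w v) = 0"
      by (rule basis_eq[OF comp[OF \<pi>(1) w(1)] zero]) (simp_all add: \<pi> w zeros adds scales \<pi>h)
    show "w (\<pi> v) = w v"
      by (rule basis_eq[OF comp[OF w(1) \<pi>(1)] w(1)]) (simp_all add: \<pi> w zeros)
    show "\<pi> (M (\<pi> v)) = x (w v)"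
      by (rule basis_eq[OF comp[OF \<pi>(1) comp[OF M_lin \<pi>(1)]] comp[OF x(1) w(1)]]) (simp_all add: \<pi> w zeros M_def C_E C_t adds scales \<pi>h xh x on_I QZ(3) C_lin[THEN endo_zero])
    show "M (v + \<pi> v) + \<pi> (M (v + \<pi> v)) = w (x v)"
    proof (rule basis_eq[OF plus[OF comp[OF M_lin v\<pi>] comp[OF \<pi>(1) comp[OF M_lin v\<pi>]]] comp[OF w(1) x(1)]])
      (* The diagonal entry of M at l is \<alpha> + \<tau>, which is 0. *)
      fix b assume "b \<in> L"
      then show "M (b + \<pi> b) + \<pi> (M (b + \<pi> b)) = w (x b)"
        using L hk by (auto simp: x zeros M_def C_L adds scales \<pi>h l on_I k(1) ac_simps)
    qed (simp_all add: \<pi> w zeros M_def C_J C_\<kappa> adds scales \<pi>h x on_I I(2) QZ(4) C_lin[THEN endo_zero] ac_simps)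
  qed
  define \<Phi> where "\<Phi> v = v + \<sigma> (c v)" for v
  define \<Psi> where "\<Psi> v = v + h v" for v
  have \<Phi>_lin: "endomorphism scale \<Phi>" and \<Psi>_lin: "endomorphism scale \<Psi>"
    unfolding \<Phi>_def \<Psi>_def by (rule plus[OF id comp[OF \<sigma>(1) c(1)]] plus[OF id h])+
  have \<Phi>\<Phi>: "\<Phi> (\<Phi> v) = v" and \<Psi>\<Psi>: "\<Psi> (\<Psi> v) = v" for v
    by (simp_all add: \<Phi>_def \<Psi>_def adds on_I c_in hh zeros add.assoc)
  have "\<Phi> (\<Psi> (M (\<Psi> (\<Phi> v)))) = \<alpha> *s v + u v" for v
  proof -
    have "M (\<Psi> s) = \<Psi> (\<alpha> *s s + (u s + c s))" for s
    proof -
      have "C (\<Psi> s) = u (\<Psi> (\<Psi> s)) + c (\<Psi> (\<Psi> s))" by (simp only: C_def \<Psi>_def)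
      then have "C (\<Psi> s) = u s + c s" by (simp only: \<Psi>\<Psi>)
      then show ?thesis by (simp add: M_def \<Psi>_def adds scales scale_right_distrib ac_simps)
    qed
    then have "\<Phi> (\<Psi> (M (\<Psi> (\<Phi> v)))) = \<Phi> (\<alpha> *s \<Phi> v + (u (\<Phi> v) + c (\<Phi> v)))"
      by (simp add: \<Psi>\<Psi>)
    also have "u (\<Phi> v) + c (\<Phi> v) = u v"
      by (simp add: \<Phi>_def adds on_I c_in \<sigma>(2) ac_simps)
    also have "\<Phi> (\<alpha> *s \<Phi> v + u v) = \<alpha> *s v + u v"
      by (simp add: endo_add[OF \<Phi>_lin] endo_scale[OF \<Phi>_lin] \<Phi>\<Phi>) (simp add: \<Phi>_def on_I I(2) zeros)
    finally show ?thesis .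
  qed
  moreover have "three_square_zero (\<lambda>v. \<Phi> (\<Psi> (M (\<Psi> (\<Phi> v)))))"
    using three_square_zero_conj[OF \<open>three_square_zero M\<close> comp[OF \<Phi>_lin \<Psi>_lin] comp[OF \<Psi>_lin \<Phi>_lin]]
    by (simp add: \<Phi>\<Phi> \<Psi>\<Psi>)
  ultimately show ?thesis by simp
qed

end

text \<open>
  An infinite set has the same cardinality as its sum with itself, and adding finitely many elements to one
  half does not change that. The elements of \<open>X\<close> will be the basis vectors that are needed for a section
  of \<open>u\<close>; they lie outside the kernel of \<open>u\<close>, but they can be matched with vectors of the kernel.
\<close>

lemma infinite_split_absorbing_finite:
  assumes "infinite K" "finite X"
  shows "\<exists>A t. A \<subseteq> K \<and> bij_betw t (X \<union> A) (K - A)"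
proof -
  include cardinal_syntax
  obtain f where f: "bij_betw f (K <+> K) K"
    using card_of_Plus_infinite1[OF assms(1), of K] card_of_ordIso card_of_refl ordIso_imp_ordLeq by blast
  define A where "A = f ` Inl ` K"
  have inj: "inj_on f (K <+> K)" and img: "f ` (K <+> K) = K" using f by (auto simp: bij_betw_def)
  have "A \<union> f ` Inr ` K = K"
    using img unfolding A_def by (simp only: Plus_def image_Un)
  moreover have "A \<inter> f ` Inr ` K = {}"
    using inj by (auto simp: A_def inj_on_def)
  ultimately have KA: "K - A = f ` Inr ` K" by blast
  have A: "A \<subseteq> K" using img by (auto simp: A_def Plus_def)
  have "inj_on (f \<circ> Inl) K" "inj_on (f \<circ> Inr) K"
    using inj by (auto simp: inj_on_def)
  then have "bij_betw (f \<circ> Inl) K A" "bij_betw (f \<circ> Inr) K (K - A)"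
    unfolding KA by (simp_all add: bij_betw_def A_def image_comp)
  then have iso: "|A| =o |K|" "|K| =o |K - A|"
    using card_of_ordIso ordIso_symmetric by blast+
  have "|X| \<le>o |K|" by (rule ordLeq3_finite_infinite[OF assms(2,1)])
  then have "|X \<union> A| \<le>o |K|"
    using assms(1) card_of_mono1[OF A]
    by (intro card_of_Un_ordLeq_infinite_Field[OF _ _ _ card_of_Card_order]) (simp_all add: Field_card_of)
  moreover have "|K| \<le>o |X \<union> A|"
    using iso(1) card_of_mono1[of A "X \<union> A"] by (metis Un_upper2 ordIso_ordLeq_trans ordIso_symmetric)
  ultimately have "|X \<union> A| =o |K - A|"
    using iso(2) ordIso_iff_ordLeq ordIso_transitive by blast
  then show ?thesis using A card_of_ordIso by blast
qed

section \<open>Scalar plus finite rank\<close>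

context char_two_space
begin

text \<open>
  The basis \<open>B\<close> is built in three steps: a Hessenberg basis \<open>E\<close> of the image, finitely many vectors that make
  it a basis \<open>B0\<close> of a space containing the values of a section of \<open>u\<close>, and infinitely many vectors of the kernel. It is
  among the last ones that the copies of \<open>E\<close> and \<open>J\<close> and the vector \<open>l\<close> are found.
\<close>

theorem scalar_plus_finite_rank_three_square_zero:
  assumes inf: "\<not> finite_dim_subspace scale UNIV" and fr: "finite_rank scale u"
    and tr: "finite_rank_trace scale u \<in> {0, \<alpha>}"
  shows "three_square_zero (\<lambda>v. \<alpha> *s v + u v)"
proof -
  have u: "endomorphism scale u" using fr by (simp add: finite_rank_def)
  obtain S where S: "finite S" "span S = range u"
    using fr by (auto simp: finite_rank_def finite_dim_subspace_def)

  (* A start at a vector that is not an eigenvector gives u (e 0) = e 1. If there is no such vector,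
     then all columns are diagonal and the condition on the start is vacuous. *)
  obtain e r where e: "inj_on e {..<r}" "independent (e ` {..<r})" "span (e ` {..<r}) = range u"
    and hess: "\<And>j. j < r \<Longrightarrow> u (e j) \<in> span (e ` {..j}) \<or> Suc j < r \<and> u (e j) = e (Suc j)"
    and start: "\<And>j. j < r \<Longrightarrow> u (e j) \<notin> span (e ` {..j}) \<Longrightarrow> 1 < r \<and> u (e 0) = e 1"
  proof (cases "\<exists>v\<in>range u. u v \<notin> span {v}")
    case True
    then obtain v where v: "v \<in> range u" "u v \<notin> span {v}" by blast
    then have "v \<noteq> 0" by (auto simp: endo_zero[OF u])
    moreover have "(\<lambda>_. v) ` {..<1::nat} = {v}" "inj_on (\<lambda>_. v) {..<1::nat}"
      by (auto simp: inj_on_def)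
    ultimately obtain e r where *: "1 \<le> r" "\<forall>i<1. e i = v" "inj_on e {..<r}" "independent (e ` {..<r})"
      "span (e ` {..<r}) = range u"
      "\<forall>j<r. u (e j) \<in> span (e ` {..j}) \<or> Suc j < r \<and> u (e j) = e (Suc j)"
      using hessenberg_extension[OF S, of u "\<lambda>_. v" 1] v(1) by (simp del: lessThan_iff) blast
    have "1 < r \<and> u (e 0) = e 1"
      using *(1,2,6) v(2) by force
    then show thesis using that[of e r] * by blast
  next
    case False
    obtain e r where *: "inj_on e {..<r}" "independent (e ` {..<r})" "span (e ` {..<r}) = range u"
      "\<forall>j<r. u (e j) \<in> span (e ` {..j}) \<or> Suc j < r \<and> u (e j) = e (Suc j)"
      using hessenberg_extension[OF S, of u "\<lambda>_. 0" 0] independent_empty by auto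
    have "u (e j) \<in> span (e ` {..j})" if "j < r" for j
    proof -
      have "e j \<in> range u" using that *(3) span_base[of "e j" "e ` {..<r}"] by auto
      then have "u (e j) \<in> span {e j}" using False by auto
      then show ?thesis using span_mono[of "{e j}" "e ` {..j}"] by auto
    qed
    then show thesis using that[of e r] * by blast
  qed
  define E where "E = e ` {..<r}"
  have E: "finite E" "independent E" "span E = range u" using e by (auto simp: E_def)

  have "\<exists>s. \<forall>b\<in>E. u (s b) = b"
    using E(3) span_base[of _ E] by (intro bchoice) (metis imageE)
  then obtain s where s: "\<And>b. b \<in> E \<Longrightarrow> u (s b) = b" by blast
  obtain \<sigma> where \<sigma>: "endomorphism scale \<sigma>" "\<And>b. b \<in> E \<Longrightarrow> \<sigma> b = s b"
    using pair.linear_independent_extend[OF E(2), of s] by blast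
  have u\<sigma>: "u (\<sigma> y) = y" if "y \<in> span E" for y
  proof -
    have "endomorphism scale (\<lambda>y. u (\<sigma> y))" "endomorphism scale (\<lambda>y. y)"
      by (auto intro!: endoI simp: u \<sigma>(1) endo_add endo_scale)
    from pair.linear_eq_on[OF this that] show ?thesis using \<sigma>(2) s by simp
  qed
  obtain B0 where B0: "E \<subseteq> B0" "B0 \<subseteq> E \<union> s ` E" "independent B0" "E \<union> s ` E \<subseteq> span B0"
    by (rule maximal_independent_subset_extend[OF Un_upper1 E(2)])
  have finB0: "finite B0" using B0(2) E(1) by (auto intro: finite_subset)
  have \<sigma>B0: "\<sigma> y \<in> span B0" if "y \<in> span E" for y
    using that
    by (induction rule: span_induct_alt)
      (use B0(4) \<sigma> in \<open>auto simp: endo_zero endo_add endo_scale span_zero intro!: span_add span_scale\<close>)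
  obtain B where B: "B0 \<subseteq> B" "B \<subseteq> B0 \<union> {v. u v = 0}" "independent B" "B0 \<union> {v. u v = 0} \<subseteq> span B"
    by (rule maximal_independent_subset_extend[OF Un_upper1 B0(3)])
  have "v \<in> span B" for v
  proof -
    have "u v \<in> span E" using E(3) by simp
    then have "\<sigma> (u v) \<in> span B" "u (v + \<sigma> (u v)) = 0"
      using \<sigma>B0 span_mono[OF B(1)] by (auto simp: endo_add[OF u] u\<sigma>)
    then have "\<sigma> (u v) + (v + \<sigma> (u v)) \<in> span B"
      using B(4) by (intro span_add[of "\<sigma> (u v)" B "v + \<sigma> (u v)"]) auto
    then show ?thesis by (simp add: add.left_commute)
  qed
  then have spanB: "span B = UNIV" by auto
  have "infinite B" using inf spanB by (auto simp: finite_dim_subspace_def)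
  then have infK: "infinite (B - B0)" using finB0 by simp

  define \<tau> where "\<tau> = (\<Sum>j<r. representation B (u (e j)) (e j))"
  have "finite_rank_trace scale u = (\<Sum>b\<in>E. representation E (u b) b)"
    using E by (intro trace_eq_sum_basis[OF fr]) auto
  also have "\<dots> = (\<Sum>b\<in>E. representation B (u b) b)"
    using B(1) B0(1) E(3) by (intro sum.cong refl fun_cong[OF representation_extend[OF B(3), symmetric]]) auto
  also have "\<dots> = \<tau>" unfolding \<tau>_def E_def using e(1) by (simp add: sum.reindex)
  finally have \<tau>: "\<tau> \<in> {0, \<alpha>}" using tr by simp
  have "\<exists>Q Z \<phi> k. endomorphism scale Q \<and> endomorphism scale Z \<and>
    (\<forall>s t v w. \<phi> (s *s v + t *s w) = s * \<phi> v + t * \<phi> w) \<and>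
    (\<forall>v. Q v \<in> span E \<and> Z v \<in> span E) \<and> (\<forall>b\<in>B - e ` {..<r}. Q b = 0 \<and> Z b = 0 \<and> \<phi> b = 0) \<and>
    k \<in> span E \<and> Q k = 0 \<and> \<tau> * \<phi> k = \<tau> \<and>
    (\<forall>v\<in>span E. u v = Q (Z v) + Z (Q v) + (\<tau> * \<phi> v) *s k)"
  proof (rule commutator_plus_rank_one[OF u B(3) spanB e(1)])
    show "e ` {..<r} \<subseteq> B" using B(1) B0(1) by (auto simp: E_def)
    show "span E = span (e ` {..<r})" by (simp add: E_def)
    show "u v \<in> span E" for v using E(3) by simp
  qed (use hess start \<tau>_def in auto)
  then obtain Q Z \<phi> k where QZ: "endomorphism scale Q" "endomorphism scale Z"
    "\<And>s t v w. \<phi> (s *s v + t *s w) = s * \<phi> v + t * \<phi> w" "\<And>v. Q v \<in> span E" "\<And>v. Z v \<in> span E"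
    "\<And>b. b \<in> B - E \<Longrightarrow> Q b = 0 \<and> Z b = 0 \<and> \<phi> b = 0"
    "k \<in> span E" "Q k = 0" "\<tau> * \<phi> k = \<tau>"
    "\<And>v. v \<in> span E \<Longrightarrow> u v = Q (Z v) + Z (Q v) + (\<tau> * \<phi> v) *s k"
    unfolding E_def by blast

  obtain P where P: "P \<subseteq> B - B0" "finite P" "card P = card E"
    using infinite_arbitrarily_large[OF infK] by blast
  then obtain \<kappa> where \<kappa>: "bij_betw \<kappa> E P" using E(1) finite_same_card_bij by metis
  have infKP: "infinite (B - B0 - P)" using infK P(2) by simp
  obtain l L where L: "L \<subseteq> B - B0 - P" "finite L" "L = {l} \<and> \<tau> = \<alpha> \<or> L = {} \<and> l = 0 \<and> \<tau> = 0"
  proof (cases "\<tau> = 0")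
    case True
    then show thesis using that[of "{}" 0] by simp
  next
    case False
    obtain l where "l \<in> B - B0 - P" using infinite_imp_nonempty[OF infKP] by auto
    then show thesis using that[of "{l}" l] False \<tau> by auto
  qed
  have "infinite (B - B0 - P - L)" using infKP L(2) by simp
  then obtain A t where At: "A \<subseteq> B - B0 - P - L" "bij_betw t (B0 - E \<union> A) (B - B0 - P - L - A)"
    using infinite_split_absorbing_finite[of "B - B0 - P - L" "B0 - E"] finB0 by auto
  have images: "\<kappa> ` E = P" "t ` (B0 - E \<union> A) = B - B0 - P - L - A"
    and injs: "inj_on \<kappa> E" "inj_on t (B0 - E \<union> A)"
    using \<kappa> At(2) by (auto simp: bij_betw_def)
  show ?thesis
  proof (rule three_square_zero_of_model[where J = "B0 - E \<union> A" and L = L and l = l and \<kappa> = \<kappa> and t = t])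
    show "u b = 0" if "b \<in> B - B0" for b using that B(2) by auto
    show "B = E \<union> (B0 - E \<union> A) \<union> \<kappa> ` E \<union> L \<union> t ` (B0 - E \<union> A)"
      unfolding images using B0(1) B(1) P(1) L(1) At(1) by blast
    show "(E \<union> (B0 - E \<union> A)) \<inter> \<kappa> ` E = {}" "(E \<union> (B0 - E \<union> A) \<union> \<kappa> ` E) \<inter> L = {}"
      "(E \<union> (B0 - E \<union> A) \<union> \<kappa> ` E \<union> L) \<inter> t ` (B0 - E \<union> A) = {}"
      "E \<inter> (B0 - E \<union> A) = {}"
      unfolding images using B0(1) P(1) L(1) At(1) by blast+
    show "u v \<in> span E" for v using E(3) by simp
    show "B0 \<subseteq> E \<union> (B0 - E \<union> A)" by blast
  qed (fact u B(3) spanB B0(1) \<sigma>(1) u\<sigma> \<sigma>B0 QZ injs L(3))+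
qed

end

theorem corollary1p6:
  fixes scale :: "'a::field \<Rightarrow> 'v::ab_group_add \<Rightarrow> 'v"
    and \<alpha> :: 'a
    and u :: "'v \<Rightarrow> 'v"
  assumes "vector_space scale"
    and "CHAR('a) = 2"
    and "\<not> finite_dim_subspace scale (UNIV :: 'v set)"
    and "finite_rank scale u"
    and "finite_rank_trace scale u \<in> {0, \<alpha>}"
  shows "\<exists>a b c. square_zero scale a \<and> square_zero scale b
      \<and> square_zero scale c
      \<and> (\<lambda>v. scale \<alpha> v + u v) = (\<lambda>v. a v + b v + c v)"
proof -
  interpret vector_space scale by (rule assms(1))
  have "(1::'a) + 1 = 0"
    using of_nat_CHAR[where 'a = 'a] assms(2) by simp
  then have "v + v = 0" for v :: 'v
    using scale_left_distrib[of 1 1 v] by simp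
  then interpret char_two_space scale by unfold_locales
  show ?thesis
    using scalar_plus_finite_rank_three_square_zero[OF assms(3-5)]
    by (simp add: three_square_zero_def)
qed

end
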